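(* For any $\epsilon>0$, one can choose an integer $k>0$ such that $$\max\left(\frac1k,\ \sum_{j=k+1}^{+\infty}\frac{\xi(j+2-k,\,j+k)^2}{(1+j)^2}\right)\le\epsilon,\qquad \xi(i,j):=\sum_{q=i}^{j}\frac1q .$$ For such $k$, let $f(z)=\sum_{j=-(k-1)}^{k-1}a_jz^j$ with $a_{j-i}=\mathcal{C}^\gamma_{i,j}$ for $|i-j|<k$, and let $\lambda$ be any complex number with $I(f(\mathbb{T}),\lambda)\neq0$. Then for some $\rho<1$ and any sufficiently large $N>4k$, there exist nonzero pseudo-eigenvectors $\mathbf{v}^{(N)}$ of $\mathcal{C}^\gamma_{N,k}$ with $\|\mathbf{v}^{(N)}\|_2=1$ satisfying $$\left\|\left(\mathcal{C}^\gamma_{N,k}-\lambda I\right)\mathbf{v}^{(N)}\right\|_2<\max\left(C_1,C_2N^{k-1}\right)\rho^{N-2k+2}+\delta K\sqrt{10\epsilon}$$ and such that, for $1\le j\le N$, $$\frac{\left|(\mathbf{v}^{(N)})_j\right|}{\max_{j}\left|(\mathbf{v}^{(N)})_j\right|}\le\begin{cases}C_3\rho^{j-1},&\text{if } I(f(\mathbb{T}),\lambda)>0,\\ C_3\rho^{N-j},&\text{if } I(f(\mathbb{T}),\lambda)<0,\end{cases}$$ where $C_1,C_2,C_3$ are independent of $N$. In particular, the constant $\rho$ can be taken to be any number such that $1>\rho\ge r$ with $I(f(\mathbb{T}_r),\lambda)>0$, or $\frac1\rho\ge\frac1r>1$ with $I(f(\mathbb{T}_{1/r}),\lambda)<0$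.
   Context: Geometry: $D\subset[0,1)\times\mathbb{R}^2$ is a simply connected bounded domain of class $C^{1,s}$, $0<s<1$; $D_i=D+(i,0,0)^\top$ (pairwise disjoint closures), $\mathcal{D}_N=\bigcup_{i=1}^ND_i$; $\gamma\in\mathbb{R}\setminus\{0\}$ and $\delta>0$ are fixed. Gauge capacitance matrix: with $\mathcal{S}^0_{\mathcal{D}_N}[\phi](x)=-\int_{\partial\mathcal{D}_N}\frac{\phi(y)}{4\pi|x-y|}\,\mathrm{d}\sigma(y)$ (an invertible operator $L^2(\partial\mathcal{D}_N)\to H^1(\partial\mathcal{D}_N)$), $$(\mathcal{C}_N^\gamma)_{i,j}=-\frac{\delta}{\int_{D_i}e^{\gamma x_1}\,\mathrm{d}x}\int_{\partial D_i}e^{\gamma x_1}(\mathcal{S}^0_{\mathcal{D}_N})^{-1}[\chi_{\partial D_j}]\,\mathrm{d}\sigma,\qquad 1\le i,j\le N,$$ where $\chi$ denotes an indicator function. Its $k$-banded version is $(\mathcal{C}^\gamma_{N,k})_{i,j}=(\mathcal{C}^\gamma_N)_{i,j}$ if $|i-j|<k$, and $0$ if $|i-j|\ge k$. Infinite (Toeplitz) gauge capacitance matrix: for $\alpha\in Y^*=\mathbb{R}/2\pi\mathbb{Z}$, $\alpha\neq0$, let $\mathcal{S}^{\alpha,0}_D[\phi](x)=-\int_{\partial D}\sum_{m\in\mathbb{Z}}\frac{e^{\mathrm{i}\alpha m}}{4\pi|x-y-(m,0,0)^\top|}\phi(y)\,\mathrm{d}\sigma(y)$, $$\hat{\mathcal{C}}^{\alpha,\gamma}=-\frac{\delta}{\int_De^{\gamma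 x_1}\,\mathrm{d}x}\int_{\partial D}e^{\gamma x_1}(\mathcal{S}^{\alpha,0}_D)^{-1}[\chi_{\partial D}]\,\mathrm{d}\sigma,\qquad \mathcal{C}^\gamma_{i,j}=\frac1{|Y^*|}\int_{Y^*}\hat{\mathcal{C}}^{\alpha,\gamma}e^{-\mathrm{i}\alpha(j-i)}\,\mathrm{d}\alpha,\quad |Y^*|=2\pi.$$ The entry $\mathcal{C}^\gamma_{i,j}$ depends only on $j-i$. The constant $K$ is a constant, independent of $N$, for which $$|(\mathcal{C}^\gamma_N)_{i,j}-\mathcal{C}^\gamma_{i,j}|\le\frac{\delta K}{(1+\min(i,N-i))(1+\min(j,N-j))}\quad\text{for all }1\le i,j\le N.$$ $\mathbb{T}=\{|z|=1\}$, $\mathbb{T}_r=\{|z|=r\}\subset\mathbb{C}$; for a curve, $I(f(\mathbb{T}_r),\lambda)$ is the winding number of $f(\mathbb{T}_r)$ around $\lambda$, with $\mathbb{T}_r$ traversed counterclockwise (it is defined only when $\lambda\notin f(\mathbb{T}_r)$). $I$ is the identity matrix in $\mathcal{C}^\gamma_{N,k}-\lambda I$. *)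

theory Defs
  imports "HOL-Complex_Analysis.Complex_Analysis"
begin

section \<open>Domains of class C1,s\<close>

text \<open>Locally, after an orthogonal change of coordinates, the domain is the strict
  epigraph of a function on the plane whose gradient is Hoelder continuous with exponent s.
  Asking for a globally defined graph function with a global Hoelder constant
  is no restriction, since only its values near one point are used.\<close>

definition holder_C1 :: "real \<Rightarrow> (real^2 \<Rightarrow> real) \<Rightarrow> bool" where
  "holder_C1 s g \<longleftrightarrow>
     (\<exists>G L. (\<forall>x. GDERIV g x :> G x) \<and>
            (\<forall>x y. norm (G x - G y) \<le> L * norm (x - y) powr s))"

definition C1s_boundary :: "real \<Rightarrow> (real^3) set \<Rightarrow> bool" where
  "C1s_boundary s D \<longleftrightarrow>
     (\<forall>p\<in>frontier D. \<exists>(R :: real^3 \<Rightarrow> real^3) g r. orthogonal_transformation R \<and> holder_C1 s g \<and> 0 < r \<and>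
        (\<forall>x\<in>ball p r. x \<in> D \<longleftrightarrow> g (vector [R x $ 1, R x $ 2]) < R x $ 3))"


section \<open>Surface measure\<close>

text \<open>The surface measure on the boundary of a C1 domain is the two-dimensional Hausdorff measure,
  with the normalisation (area of a disc of given diameter) for which it is ordinary area on planes.
  As Hausdorff measure is countably additive on Borel sets, \<open>measure_of\<close> returns it
  unchanged.\<close>

definition hausdorff2_pre :: "real \<Rightarrow> (real^3) set \<Rightarrow> ennreal" where
  "hausdorff2_pre d A =
     (INF U \<in> {U :: nat \<Rightarrow> (real^3) set.
                 A \<subseteq> (\<Union>n. U n) \<and> (\<forall>n. bounded (U n) \<and> diameter (U n) \<le> d)}.
        \<Sum>n. ennreal (pi / 4 * (diameter (U n))\<^sup>2))"

definition hausdorff2 :: "(real^3) set \<Rightarrow> ennreal" where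
  "hausdorff2 A = (SUP d\<in>{0<..}. hausdorff2_pre d A)"

definition surface_measure :: "(real^3) measure" where
  "surface_measure = measure_of UNIV (sets borel) hausdorff2"


section \<open>Single layer potentials\<close>

definition L2_surface :: "(real^3) set \<Rightarrow> (real^3 \<Rightarrow> complex) set" where
  "L2_surface S = {\<phi>. set_borel_measurable surface_measure S \<phi> \<and>
                       set_integrable surface_measure S (\<lambda>y. (cmod (\<phi> y))\<^sup>2)}"

definition shift :: "int \<Rightarrow> real^3" where
  "shift m = of_int m *\<^sub>R axis 1 1"

definition green :: "real^3 \<Rightarrow> complex" where
  "green z = of_real (1 / (4 * pi * norm z))"

text \<open>The lattice sum converges only conditionally (and only for \<open>\<alpha>\<close> not a multiple of
  \<open>2 * pi\<close>); it is the limit of the symmetric partial sums.\<close>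

definition quasi_green :: "real \<Rightarrow> real^3 \<Rightarrow> complex" where
  "quasi_green \<alpha> z =
     lim (\<lambda>M. \<Sum>m\<in>{- int M..int M}. exp (\<i> * of_real (\<alpha> * of_int m)) * green (z - shift m))"

definition single_layer ::
  "(real^3 \<Rightarrow> complex) \<Rightarrow> (real^3) set \<Rightarrow> (real^3 \<Rightarrow> complex) \<Rightarrow> real^3 \<Rightarrow> complex" where
  "single_layer G S \<phi> x = - (LINT y:S|surface_measure. G (x - y) * \<phi> y)"

text \<open>Elements of \<open>L\<^sup>2\<close> are classes modulo null sets, so the inverse is a representative of the
  unique class of square integrable densities whose potential agrees almost everywhere on the
  surface with the given function.\<close>

definition single_layer_inv ::
  "(real^3 \<Rightarrow> complex) \<Rightarrow> (real^3) set \<Rightarrow> (real^3 \<Rightarrow> complex) \<Rightarrow> real^3 \<Rightarrow> complex" where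
  "single_layer_inv G S h =
     (SOME \<phi>. \<phi> \<in> L2_surface S \<and> (AE x\<in>S in surface_measure. single_layer G S \<phi> x = h x))"


section \<open>Gauge capacitance matrices\<close>

definition resonator :: "(real^3) set \<Rightarrow> int \<Rightarrow> (real^3) set" where
  "resonator D i = (\<lambda>x. x + shift i) ` D"

definition resonators :: "(real^3) set \<Rightarrow> nat \<Rightarrow> (real^3) set" where
  "resonators D N = (\<Union>i\<in>{1..N}. resonator D (int i))"

definition gauge_flux :: "real \<Rightarrow> real \<Rightarrow> (real^3) set \<Rightarrow> (real^3 \<Rightarrow> complex) \<Rightarrow> complex" where
  "gauge_flux \<gamma> \<delta> B \<psi> =
     - of_real (\<delta> / (LINT x:B|lborel. exp (\<gamma> * x $ 1))) *
       (LINT x:frontier B|surface_measure. of_real (exp (\<gamma> * x $ 1)) * \<psi> x)"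

text \<open>Matrix indices run over \<open>{1..N}\<close>; values outside this range are irrelevant.\<close>

definition cap_matrix ::
  "(real^3) set \<Rightarrow> real \<Rightarrow> real \<Rightarrow> nat \<Rightarrow> nat \<Rightarrow> nat \<Rightarrow> complex" where
  "cap_matrix D \<gamma> \<delta> N i j =
     gauge_flux \<gamma> \<delta> (resonator D (int i))
       (single_layer_inv green (frontier (resonators D N))
          (indicator (frontier (resonator D (int j)))))"

definition banded_cap_matrix ::
  "(real^3) set \<Rightarrow> real \<Rightarrow> real \<Rightarrow> nat \<Rightarrow> nat \<Rightarrow> nat \<Rightarrow> nat \<Rightarrow> complex" where
  "banded_cap_matrix D \<gamma> \<delta> N k i j =
     (if \<bar>int i - int j\<bar> < int k then cap_matrix D \<gamma> \<delta> N i j else 0)"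

definition quasi_cap :: "(real^3) set \<Rightarrow> real \<Rightarrow> real \<Rightarrow> real \<Rightarrow> complex" where
  "quasi_cap D \<gamma> \<delta> \<alpha> =
     gauge_flux \<gamma> \<delta> D
       (single_layer_inv (quasi_green \<alpha>) (frontier D) (indicator (frontier D)))"

text \<open>The period cell is represented by \<open>[-pi, pi]\<close>; the exceptional point \<open>\<alpha> = 0\<close> is
  a null set.\<close>

definition cap_infinite :: "(real^3) set \<Rightarrow> real \<Rightarrow> real \<Rightarrow> int \<Rightarrow> int \<Rightarrow> complex" where
  "cap_infinite D \<gamma> \<delta> i j =
     of_real (1 / (2 * pi)) *
       (LINT \<alpha>:{-pi..pi}|lborel.
          quasi_cap D \<gamma> \<delta> \<alpha> * exp (- (\<i> * of_real (\<alpha> * of_int (j - i)))))"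


section \<open>Band widths, symbols and pseudo-eigenvectors\<close>

definition xi :: "nat \<Rightarrow> nat \<Rightarrow> real" where
  "xi i j = (\<Sum>q\<in>{i..j}. 1 / real q)"

definition band_term :: "nat \<Rightarrow> nat \<Rightarrow> real" where
  "band_term k j = (xi (j + 2 - k) (j + k))\<^sup>2 / (1 + real j)\<^sup>2"

definition band_width_ok :: "real \<Rightarrow> nat \<Rightarrow> bool" where
  "band_width_ok \<epsilon> k \<longleftrightarrow>
     0 < k \<and> summable (\<lambda>n. band_term k (n + (k + 1))) \<and>
     max (1 / real k) (\<Sum>n. band_term k (n + (k + 1))) \<le> \<epsilon>"

definition symbol :: "nat \<Rightarrow> (int \<Rightarrow> complex) \<Rightarrow> complex \<Rightarrow> complex" where
  "symbol k a z = (\<Sum>j\<in>{- (int k - 1)..int k - 1}. a j * z powi j)"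

text \<open>The winding number of the library is complex valued; off the curve it is an integer.\<close>

definition circle_index :: "(complex \<Rightarrow> complex) \<Rightarrow> real \<Rightarrow> complex \<Rightarrow> real" where
  "circle_index f r z = Re (winding_number (f \<circ> circlepath 0 r) z)"

definition residual :: "nat \<Rightarrow> (nat \<Rightarrow> nat \<Rightarrow> complex) \<Rightarrow> complex \<Rightarrow> (nat \<Rightarrow> complex) \<Rightarrow> real" where
  "residual N A z v =
     L2_set (\<lambda>i. cmod (\<Sum>j\<in>{1..N}. (A i j - (if i = j then z else 0)) * v j)) {1..N}"

text \<open>\<open>A N\<close> is the \<open>N \<times> N\<close> matrix of a family with band width \<open>k\<close>, and \<open>err\<close> is the part of the
  bound that does not decay with \<open>N\<close>.\<close>

definition localized_pseudo_eigenvectors ::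
  "(nat \<Rightarrow> nat \<Rightarrow> nat \<Rightarrow> complex) \<Rightarrow> nat \<Rightarrow> (complex \<Rightarrow> complex) \<Rightarrow> complex \<Rightarrow> real \<Rightarrow> real \<Rightarrow> bool"
where
  "localized_pseudo_eigenvectors A k f z err \<rho> \<longleftrightarrow>
     (\<exists>C1 C2 C3 :: real. \<exists>N0. \<forall>N\<ge>N0. 4 * k < N \<longrightarrow>
       (\<exists>v :: nat \<Rightarrow> complex.
          L2_set (\<lambda>j. cmod (v j)) {1..N} = 1 \<and>
          residual N (A N) z v < max C1 (C2 * real N ^ (k - 1)) * \<rho> ^ (N - 2 * k + 2) + err \<and>
          (\<forall>j\<in>{1..N}.
             (circle_index f 1 z > 0 \<longrightarrow>
                cmod (v j) / Max ((\<lambda>j. cmod (v j)) ` {1..N}) \<le> C3 * \<rho> ^ (j - 1)) \<and>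
             (circle_index f 1 z < 0 \<longrightarrow>
                cmod (v j) / Max ((\<lambda>j. cmod (v j)) ` {1..N}) \<le> C3 * \<rho> ^ (N - j)))))"

end

theory Submission
  imports Defs "HOL-Computational_Algebra.Fundamental_Theorem_Algebra"
begin

text \<open>The term \<open>\<delta> * K * sqrt (10 * \<epsilon>)\<close> of the bound is positive and independent of \<open>N\<close>, so it suffices
  to find a test vector, supported in a window at the relevant end whose length does not depend on
  \<open>N\<close>, with residual below a given positive number. This also explains why every \<open>\<rho> < 1\<close> is
  admissible: \<open>C3\<close> absorbs the decay inside the window.

  Suppose the index is positive (reflection \<open>i \<mapsto> N + 1 - i\<close> reduces the other sign to this one).
  Then \<open>w ^ (k - 1) * (f w - z)\<close> has at least \<open>k\<close> zeros in the open unit disc, so the recurrence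
  given by a bulk row of the Toeplitz matrix has \<open>k\<close> independent summable solutions with prescribed
  initial values. A vector consisting of \<open>m\<close> free entries followed by such a solution has \<open>m + k\<close>
  parameters and can thus be made to satisfy exactly the first \<open>m + k - 1\<close> equations of the true
  matrix, which need not be close to Toeplitz near its corner. In the remaining rows the error comes
  from truncating the solution and from the deviation from Toeplitz form, which is small once \<open>m\<close>
  is large; as the solutions do not depend on \<open>m\<close>, both can be made small uniformly in \<open>N\<close>.\<close>

section \<open>Existence of a band width\<close>

text \<open>Telescoping: each summand \<open>1 / (x + 1)^2\<close> is at most
  \<open>1 / x - 1 / (x + 1)\<close>.\<close>

lemma sum_inverse_squares_le:
  assumes "0 < a"
  shows "(\<Sum>q\<in>{a<..a + d}. (1 / real q)\<^sup>2) \<le> 1 / real a - 1 / real (a + d)"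
proof (induction d)
  case (Suc d)
  let ?x = "real (a + d)"
  have x: "?x > 0"
    using assms by simp
  have "{a<..a + Suc d} = insert (a + Suc d) {a<..a + d}"
    by auto
  hence "(\<Sum>q\<in>{a<..a + Suc d}. (1 / real q)\<^sup>2) = (1 / (?x + 1))\<^sup>2 + (\<Sum>q\<in>{a<..a + d}. (1 / real q)\<^sup>2)"
    by (simp add: add.commute)
  also have "(1 / (?x + 1))\<^sup>2 \<le> 1 / ?x - 1 / (?x + 1)"
  proof -
    have "(1 / (?x + 1))\<^sup>2 \<le> 1 / (?x * (?x + 1))"
      using x unfolding power2_eq_square times_divide_times_eq mult_1 by (intro frac_le mult_right_mono) auto
    also have "\<dots> = 1 / ?x - 1 / (?x + 1)"
      using x by (simp only: diff_frac_eq) (simp add: field_simps)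
    finally show ?thesis .
  qed
  also note Suc
  finally show ?case
    by (simp add: add.commute)
qed simp

text \<open>Splits the decay between \<open>k\<close> and \<open>n\<close>: a summable power of
  \<open>n\<close> remains, and the factor \<open>1 / sqrt k\<close> makes the whole series small
  for large \<open>k\<close>.\<close>

lemma band_term_le:
  assumes "0 < k"
  shows "band_term k (n + (k + 1)) \<le> 2 / sqrt (real k) * (1 / real (Suc n) powr (3 / 2))"
proof -
  define x where "x = real (n + k + 2)"
  have x: "x \<ge> real k" "x \<ge> real (Suc n)" "x > 0"
    by (simp_all add: x_def)
  have ivl: "{n + (k + 1) + 2 - k..n + (k + 1) + k} = {n + 2<..(n + 2) + (2 * k - 1)}"
    using assms by auto
  \<comment> \<open>Cauchy-Schwarz for the \<open>2 * k - 1\<close> summands of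
    \<open>xi\<close>.\<close>
  have "(xi (n + (k + 1) + 2 - k) (n + (k + 1) + k))\<^sup>2
      \<le> real (2 * k - 1) * (\<Sum>q\<in>{n + 2<..(n + 2) + (2 * k - 1)}. (1 / real q)\<^sup>2)"
    unfolding xi_def ivl using sum_squared_le_sum_of_squares[of "\<lambda>q. 1 / real q" "{n + 2<..(n + 2) + (2 * k - 1)}"]
    by (simp add: mult.commute)
  also have "(\<Sum>q\<in>{n + 2<..(n + 2) + (2 * k - 1)}. (1 / real q)\<^sup>2) \<le> 1 / real (n + 2)"
    by (rule order_trans[OF sum_inverse_squares_le]) simp_all
  also have "\<dots> \<le> 1 / real (Suc n)"
    by (simp add: field_simps)
  also have "real (2 * k - 1) \<le> 2 * real k"
    by simp
  finally have xi: "(xi (n + (k + 1) + 2 - k) (n + (k + 1) + k))\<^sup>2 \<le> 2 * real k * (1 / real (Suc n))"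
    by (simp add: mult_left_mono divide_right_mono)
  \<comment> \<open>As \<open>x\<close> dominates both \<open>k\<close> and \<open>Suc n\<close>,
    the square of \<open>x\<close> is divided into exponents 3/2 for \<open>k\<close> and 1/2 for
    \<open>Suc n\<close>.\<close>
  have "sqrt (real k) * real k * real (Suc n) powr (1 / 2) = real k powr (3 / 2) * real (Suc n) powr (1 / 2)"
    using assms powr_add[of "real k" 1 "1 / 2"] by (simp add: powr_half_sqrt)
  also have "\<dots> \<le> x powr (3 / 2) * x powr (1 / 2)"
    using x by (intro mult_mono powr_mono2) auto
  also have "\<dots> = x\<^sup>2"
    using x by (simp add: powr_add[symmetric])
  finally have den: "sqrt (real k) * real k * real (Suc n) powr (1 / 2) \<le> x\<^sup>2" .
  have "band_term k (n + (k + 1)) = (xi (n + (k + 1) + 2 - k) (n + (k + 1) + k))\<^sup>2 / x\<^sup>2"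
    by (simp add: band_term_def x_def add_ac)
  also have "\<dots> \<le> (2 * real k * (1 / real (Suc n))) / (sqrt (real k) * real k * real (Suc n) powr (1 / 2))"
    using xi den assms by (intro frac_le) auto
  also have "\<dots> = 2 / sqrt (real k) * (1 / (real (Suc n) powr 1 * real (Suc n) powr (1 / 2)))"
    using assms by (simp add: field_simps del: of_nat_Suc)
  also have "\<dots> = 2 / sqrt (real k) * (1 / real (Suc n) powr (3 / 2))"
    unfolding powr_add[symmetric] by simp
  finally show ?thesis .
qed

lemma exists_band_width:
  assumes "0 < \<epsilon>"
  shows "\<exists>k. band_width_ok \<epsilon> k"
proof -
  define h where "h n = 1 / real (Suc n) powr (3 / 2)" for n
  have "summable (\<lambda>n. real n powr - (3 / 2))"
    by (rule summable_real_powr_iff[THEN iffD2]) simp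
  from summable_ignore_initial_segment[OF this, of 1] have h: "summable h"
    unfolding h_def[abs_def] powr_minus_divide[symmetric] by (simp only: Suc_eq_plus1)
  define H where "H = suminf h"
  have H: "H \<ge> 0"
    unfolding H_def using h by (rule suminf_nonneg) (simp add: h_def)
  \<comment> \<open>The first summand takes care of \<open>1 / k\<close>, the second of the series,
    which is at most \<open>2 * H / sqrt k\<close>.\<close>
  obtain k where k: "1 / \<epsilon> + (2 * H / \<epsilon>)\<^sup>2 < real k"
    using reals_Archimedean2 by blast
  have pos: "1 / \<epsilon> > 0" and nonneg: "(2 * H / \<epsilon>)\<^sup>2 \<ge> 0"
    using assms by auto
  have k1: "1 / \<epsilon> \<le> real k" and k2: "(2 * H / \<epsilon>)\<^sup>2 \<le> real k"
    using k pos nonneg by linarith+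
  have "0 < real k"
    using k1 pos by linarith
  hence kpos: "0 < k"
    by simp
  have sq: "2 * H / \<epsilon> \<le> sqrt (real k)"
    using k2 by (rule real_le_rsqrt)
  have term_nonneg: "0 \<le> band_term k n" for n
    by (simp add: band_term_def)
  have sm: "summable (\<lambda>n. 2 / sqrt (real k) * h n)"
    using h by (rule summable_mult)
  have sb: "summable (\<lambda>n. band_term k (n + (k + 1)))"
    by (rule summable_comparison_test'[OF sm, of 0])
      (use band_term_le[OF kpos] term_nonneg in \<open>auto simp: h_def\<close>)
  have "(\<Sum>n. band_term k (n + (k + 1))) \<le> (\<Sum>n. 2 / sqrt (real k) * h n)"
    by (rule suminf_le[OF _ sb sm]) (use band_term_le[OF kpos] in \<open>auto simp: h_def\<close>)
  also have "\<dots> = 2 / sqrt (real k) * H"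
    unfolding H_def by (rule suminf_mult[OF h])
  also have "\<dots> \<le> \<epsilon>"
    using sq kpos assms by (simp add: divide_le_eq mult.commute)
  finally show ?thesis
    unfolding band_width_ok_def using kpos k1 sb assms
    by (intro exI[of _ k] conjI max.boundedI) (simp_all add: divide_le_eq mult.commute)
qed

section \<open>Recurrences with characteristic roots in the unit disc\<close>

text \<open>This is \<open>p(S) w\<close> for the left shift \<open>S\<close>; its kernel consists
  of the solutions of the recurrence with characteristic polynomial \<open>p\<close>.\<close>

definition poly_shift :: "complex poly \<Rightarrow> (nat \<Rightarrow> complex) \<Rightarrow> nat \<Rightarrow> complex" where
  "poly_shift p w t = (\<Sum>l\<le>degree p. coeff p l * w (t + l))"

lemma poly_shift_eq_sum: "degree p \<le> n \<Longrightarrow> poly_shift p w t = (\<Sum>l\<le>n. coeff p l * w (t + l))"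
  unfolding poly_shift_def by (intro sum.mono_neutral_left) (auto simp: coeff_eq_0)

lemma poly_shift_0 [simp]: "poly_shift 0 w t = 0"
  by (simp add: poly_shift_def)

lemma poly_shift_1 [simp]: "poly_shift 1 w = w"
  by (simp add: poly_shift_def fun_eq_iff)

lemma poly_shift_smult: "poly_shift (smult c p) w t = c * poly_shift p w t"
  using degree_smult_le[of c p] 
  by (simp add: poly_shift_eq_sum[of _ "degree p"] sum_distrib_left mult.assoc)

lemma poly_shift_add: "poly_shift (p + q) w t = poly_shift p w t + poly_shift q w t"
  by (simp add: poly_shift_eq_sum[of _ "max (degree p) (degree q)"] degree_add_le
      sum.distrib algebra_simps)

lemma poly_shift_pCons: "poly_shift (pCons a p) w t = a * w t + poly_shift p w (Suc t)"
proof -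
  have "poly_shift (pCons a p) w t = (\<Sum>l\<le>Suc (degree p). coeff (pCons a p) l * w (t + l))"
    by (rule poly_shift_eq_sum[OF degree_pCons_le])
  also have "\<dots> = a * w t + (\<Sum>l\<le>degree p. coeff p l * w (Suc t + l))"
    by (subst sum.atMost_Suc_shift) simp
  finally show ?thesis
    by (simp add: poly_shift_def)
qed

text \<open>Multiplicativity of \<open>p \<mapsto> p(S)\<close>, which allows the factors of a
  polynomial to be treated one at a time.\<close>

lemma poly_shift_mult: "poly_shift (p * q) w t = poly_shift p (poly_shift q w) t"
  by (induction p arbitrary: t) (simp_all add: poly_shift_pCons poly_shift_add poly_shift_smult)

lemma poly_shift_linear: "poly_shift [:- x, 1:] w t = w (Suc t) - x * w t"
  by (simp add: poly_shift_pCons)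

text \<open>With \<open>P\<close> a partial sum of \<open>cmod (w t)\<close>, the triangle
  inequality gives \<open>P \<le> cmod (w 0) + cmod x * P + U\<close>, which can be solved for
  \<open>P\<close> because \<open>cmod x < 1\<close>.\<close>

lemma summable_first_order_recurrence:
  fixes x :: complex
  assumes x: "cmod x < 1" and u: "summable (\<lambda>t. cmod (w (Suc t) - x * w t))"
  shows "summable (\<lambda>t. cmod (w t))"
proof -
  define U where "U = (\<Sum>t. cmod (w (Suc t) - x * w t))"
  have bound: "(\<Sum>t<n. cmod (w t)) \<le> (cmod (w 0) + U) / (1 - cmod x)" for n
  proof -
    have "(\<Sum>t<n. cmod (w t)) \<le> (\<Sum>t<Suc n. cmod (w t))"
      by simp
    also have "\<dots> = cmod (w 0) + (\<Sum>t<n. cmod (w (Suc t)))"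
      by (rule sum.lessThan_Suc_shift)
    also have "(\<Sum>t<n. cmod (w (Suc t))) \<le> (\<Sum>t<n. cmod x * cmod (w t) + cmod (w (Suc t) - x * w t))"
    proof (rule sum_mono)
      fix t
      show "cmod (w (Suc t)) \<le> cmod x * cmod (w t) + cmod (w (Suc t) - x * w t)"
        using norm_triangle_ineq[of "x * w t" "w (Suc t) - x * w t"] by (simp add: norm_mult)
    qed
    also have "\<dots> \<le> cmod x * (\<Sum>t<n. cmod (w t)) + U"
      unfolding U_def using sum_le_suminf[OF u, of "{..<n}"] by (simp add: sum.distrib sum_distrib_left)
    finally show ?thesis
      using x by (simp add: field_simps)
  qed
  show ?thesis
    by (rule summableI_nonneg_bounded[OF _ bound]) simp
qed

lemma summable_of_roots_in_disc:
  assumes "\<And>x. x \<in> set xs \<Longrightarrow> cmod x < 1" and "\<And>t. poly_shift (\<Prod>x\<leftarrow>xs. [:- x, 1:]) w t = 0"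
  shows "summable (\<lambda>t. cmod (w t))"
  using assms
proof (induction xs arbitrary: w)
  case (Cons x xs)
  \<comment> \<open>The factor of \<open>x\<close> is moved to the right so that it acts on
    \<open>w\<close> first; the induction hypothesis then applies to
    \<open>(S - x) w\<close>.\<close>
  have "(\<Prod>x\<leftarrow>x # xs. [:- x, 1:]) = (\<Prod>x\<leftarrow>xs. [:- x, 1:]) * [:- x, 1:]"
    unfolding list.map prod_list.Cons by (rule mult.commute)
  hence "poly_shift (\<Prod>x\<leftarrow>xs. [:- x, 1:]) (poly_shift [:- x, 1:] w) t = 0" for t
    using Cons.prems(2)[of t] by (simp only: poly_shift_mult)
  hence "summable (\<lambda>t. cmod (poly_shift [:- x, 1:] w t))"
    using Cons.prems(1) by (intro Cons.IH[of "poly_shift [:- x, 1:] w"]) simp_all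
  thus ?case
    by (intro summable_first_order_recurrence[of x w]) (use Cons.prems(1) in \<open>simp_all add: poly_shift_linear\<close>)
qed simp

fun recurrence :: "(nat \<Rightarrow> complex) \<Rightarrow> nat \<Rightarrow> (nat \<Rightarrow> complex) \<Rightarrow> nat \<Rightarrow> complex" where
  "recurrence q k c t = (if t < k then c t else - (\<Sum>l<k. q l * recurrence q k c (t - k + l)))"

declare recurrence.simps [simp del]

lemma poly_shift_recurrence:
  assumes "degree p = k" "lead_coeff p = 1"
  shows "poly_shift p (recurrence (coeff p) k c) t = 0"
proof -
  let ?w = "recurrence (coeff p) k c"
  have "poly_shift p ?w t = (\<Sum>l<k. coeff p l * ?w (t + l)) + ?w (t + k)"
    using assms by (simp add: poly_shift_def lessThan_Suc_atMost[symmetric])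
  also have "?w (t + k) = - (\<Sum>l<k. coeff p l * ?w (t + l))"
    by (subst recurrence.simps) simp
  finally show ?thesis
    by simp
qed

text \<open>The monic divisor has degree \<open>length xs\<close>, so its recurrence can be started
  from any \<open>length xs\<close> values. Whatever it annihilates is annihilated by its multiple
  \<open>p\<close>. Repetitions in \<open>xs\<close> account for multiple roots.\<close>

lemma fundamental_solutions:
  assumes "\<And>x. x \<in> set xs \<Longrightarrow> cmod x < 1" "(\<Prod>x\<leftarrow>xs. [:- x, 1:]) dvd p"
  obtains b where "\<And>s t. t < length xs \<Longrightarrow> b s t = of_bool (s = t)"
    "\<And>s. summable (\<lambda>t. cmod (b s t))" "\<And>s t. poly_shift p (b s) t = 0"
proof -
  let ?q = "\<lambda>xs. \<Prod>x\<leftarrow>xs. [:- x, 1::complex:]"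
  let ?b = "\<lambda>s. recurrence (coeff (?q xs)) (length xs) (\<lambda>t. of_bool (s = t))"
  have q: "degree (?q xs) = length xs" "lead_coeff (?q xs) = 1" for xs
  proof (induction xs)
    case (Cons x xs)
    have nz: "?q xs \<noteq> 0"
      using Cons(2) by auto
    show "degree (?q (x # xs)) = length (x # xs)"
      using degree_mult_eq[OF _ nz, of "[:- x, 1:]"] Cons(1) by simp
    show "lead_coeff (?q (x # xs)) = 1"
      using Cons(2) by (simp only: list.map prod_list.Cons lead_coeff_mult) simp
  qed auto
  have 0: "poly_shift (?q xs) (?b s) t = 0" for s t
    by (rule poly_shift_recurrence[OF q])
  obtain r where p: "p = r * ?q xs"
    using assms(2) by (auto simp: dvd_def mult.commute)
  show ?thesis
  proof (rule that)
    show "?b s t = of_bool (s = t)" if "t < length xs" for s t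
      using that by (subst recurrence.simps) simp
    show "summable (\<lambda>t. cmod (?b s t))" for s
      by (rule summable_of_roots_in_disc[OF assms(1) 0])
    show "poly_shift p (?b s) t = 0" for s t
      unfolding p poly_shift_mult poly_shift_def[of r] 0 by simp
  qed
qed

section \<open>Winding numbers and roots of the symbol\<close>

text \<open>Argument principle by logarithmic differentiation: each \<open>x i\<close> in the disc
  contributes 1, and the pole of order \<open>p\<close> at 0 contributes \<open>- p\<close>.\<close>

lemma winding_number_compose_factored:
  fixes x :: "nat \<Rightarrow> complex" and F :: "complex \<Rightarrow> complex"
  assumes "c \<noteq> 0" and x: "\<And>i. i < n \<Longrightarrow> cmod (x i) \<noteq> 1"
    and F: "\<And>w. cmod w = 1 \<Longrightarrow> F w = z + c * (\<Prod>i<n. w - x i) / w ^ p"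
  shows "winding_number (F \<circ> circlepath 0 1) z = of_nat (card {i\<in>{..<n}. cmod (x i) < 1}) - of_nat p"
proof -
  let ?\<gamma> = "circlepath 0 1"
  define G where "G = (\<lambda>w. z + c * (\<Prod>i<n. w - x i) / w ^ p)"
  define h where "h = (\<lambda>w. (\<Sum>i<n. 1 / (w - x i)) - of_nat p * (1 / (w - 0)))"
  have on: "cmod w = 1" if "w \<in> path_image ?\<gamma>" for w
    using that by simp
  have nz: "w \<noteq> 0" "\<And>i. i < n \<Longrightarrow> w - x i \<noteq> 0" if "cmod w = 1" for w
    using that x by auto
  \<comment> \<open>Nothing is known about \<open>F\<close> off the circle, so the differentiable
    function \<open>G\<close> replaces it.\<close>
  have eq: "F \<circ> ?\<gamma> = G \<circ> ?\<gamma>"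
  proof
    fix t
    have "cmod (?\<gamma> t) = 1"
      by (simp add: circlepath norm_mult)
    thus "(F \<circ> ?\<gamma>) t = (G \<circ> ?\<gamma>) t"
      by (simp add: F G_def)
  qed
  have der: "(G has_field_derivative (G w - z) * h w) (at w)" if "cmod w = 1" for w
  proof -
    have d1: "((\<lambda>w. \<Prod>i<n. w - x i) has_field_derivative
             (\<Prod>i<n. w - x i) * (\<Sum>i<n. 1 / (w - x i))) (at w)"
      by (rule has_field_derivative_prod') (auto intro!: derivative_eq_intros dest: nz(2)[OF that])
    \<comment> \<open>Written with a division by \<open>w\<close> to avoid the truncated exponent
      \<open>p - 1\<close>.\<close>
    have d2: "((\<lambda>w. w ^ p) has_field_derivative (of_nat p * w ^ p / w)) (at w)"
      using nz(1)[OF that] by (intro DERIV_cong[OF DERIV_power[OF DERIV_ident]]) (cases p; simp)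
    show ?thesis
      unfolding G_def h_def using nz(1)[OF that]
      by (intro DERIV_cong[OF DERIV_add[OF DERIV_const DERIV_divide[OF DERIV_cmult[OF d1] d2]]])
        (auto simp: field_simps)
  qed
  have an: "G analytic_on path_image ?\<gamma>"
    unfolding G_def by (intro analytic_intros) (auto dest: on nz)
  have Gz: "G w - z \<noteq> 0" if "cmod w = 1" for w
    using nz[OF that] \<open>c \<noteq> 0\<close> by (auto simp: G_def)
  have valid: "valid_path (G \<circ> ?\<gamma>)"
    by (rule valid_path_compose_analytic[OF _ an]) auto
  have z: "z \<notin> path_image (G \<circ> ?\<gamma>)"
    using Gz on by (force simp: path_image_compose)
  have w1: "((\<lambda>w. 1 / (w - a)) has_contour_integral (2 * pi * \<i> * of_bool (cmod a < 1))) ?\<gamma>"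
    if "cmod a \<noteq> 1" for a
  proof -
    have "winding_number ?\<gamma> a = of_bool (cmod a < 1)"
    proof (cases "cmod a < 1")
      case True
      thus ?thesis by (simp add: winding_number_circlepath)
    next
      case False
      thus ?thesis using that
        by (auto intro!: winding_number_zero_outside[where s = "cball 0 1"])
    qed
    thus ?thesis
      using has_contour_integral_winding_number[of ?\<gamma> a] that by auto
  qed
  have "(h has_contour_integral
      (\<Sum>i<n. 2 * pi * \<i> * of_bool (cmod (x i) < 1)) - of_nat p * (2 * pi * \<i> * of_bool (cmod 0 < 1))) ?\<gamma>"
    unfolding h_def
    by (intro has_contour_integral_diff has_contour_integral_sum has_contour_integral_lmul w1)
      (use x in auto)
  moreover have "(\<Sum>i<n. 2 * pi * \<i> * of_bool (cmod (x i) < 1)) =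
      2 * pi * \<i> * of_nat (card {i\<in>{..<n}. cmod (x i) < 1})"
    by (simp add: sum_distrib_left[symmetric] of_bool_def sum.If_cases Int_def)
  ultimately have h: "contour_integral ?\<gamma> h =
      2 * pi * \<i> * (of_nat (card {i\<in>{..<n}. cmod (x i) < 1}) - of_nat p)"
    by (auto dest!: contour_integral_unique simp: algebra_simps)
  have "winding_number (G \<circ> ?\<gamma>) z = 1 / (2 * pi * \<i>) * contour_integral (G \<circ> ?\<gamma>) (\<lambda>w. 1 / (w - z))"
    using winding_number_valid_path[OF valid z] .
  \<comment> \<open>Pulling the integral back to the circle turns the integrand into the logarithmic
    derivative \<open>h\<close> of \<open>G - z\<close>.\<close>
  also have "contour_integral (G \<circ> ?\<gamma>) (\<lambda>w. 1 / (w - z)) =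
      contour_integral ?\<gamma> (\<lambda>w. deriv G w * (1 / (G w - z)))"
    by (rule contour_integral_comp_analyticW[OF an]) auto
  also have "\<dots> = contour_integral ?\<gamma> h"
    by (rule contour_integral_eq) (use DERIV_imp_deriv[OF der] Gz on in auto)
  finally show ?thesis
    unfolding eq h by (simp add: o_def)
qed

text \<open>The index equals the number of zeros of \<open>p\<close> in the open disc minus
  \<open>k - 1\<close>, so a positive index provides \<open>k\<close> such zeros and hence a monic
  divisor of degree \<open>k\<close>.\<close>

lemma symbol_fundamental_solutions:
  fixes a :: "int \<Rightarrow> complex"
  assumes "0 < k" and z: "z \<notin> symbol k a ` sphere 0 1" and ind: "circle_index (symbol k a) 1 z > 0"
  defines "e \<equiv> \<lambda>l. a (int l - (int k - 1)) - (if l = k - 1 then z else 0)"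
  obtains b where "\<And>s t. t < k \<Longrightarrow> b s t = of_bool (s = t)"
    "\<And>s. summable (\<lambda>t. cmod (b s t))" "\<And>s t. (\<Sum>l<2 * k - 1. e l * b s (t + l)) = 0"
proof -
  define p where "p = (\<Sum>l<2 * k - 1. monom (e l) l)"
  have coeff_p: "coeff p l = (if l < 2 * k - 1 then e l else 0)" for l
    by (simp add: p_def coeff_sum)
  have poly_p: "poly p w = w ^ (k - 1) * (symbol k a w - z)" if "w \<noteq> 0" for w
  proof -
    have "symbol k a w = (\<Sum>l<2 * k - 1. a (int l - (int k - 1)) * w powi (int l - (int k - 1)))"
      unfolding symbol_def using \<open>0 < k\<close>
      by (intro sum.reindex_bij_witness[of _ "\<lambda>l. int l - (int k - 1)" "\<lambda>j. nat (j + (int k - 1))"]) auto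
    moreover have "w ^ (k - 1) * (c * w powi (int l - (int k - 1))) = c * w ^ l" for c l
      using that \<open>0 < k\<close> by (simp add: power_int_diff of_nat_diff flip: power_int_of_nat)
    ultimately have sym: "w ^ (k - 1) * symbol k a w = (\<Sum>l<2 * k - 1. a (int l - (int k - 1)) * w ^ l)"
      by (simp only: sum_distrib_left)
    have "(\<Sum>l<2 * k - 1. (if l = k - 1 then z else 0) * w ^ l) = z * w ^ (k - 1)"
      using \<open>0 < k\<close> by (subst sum.remove[of _ "k - 1"]) (auto intro!: sum.neutral)
    with sym show ?thesis
      by (simp add: p_def e_def poly_sum poly_monom left_diff_distrib sum_subtractf algebra_simps)
  qed
  obtain x where x: "smult (lead_coeff p) (\<Prod>i<degree p. [:- x i, 1:]) = p"
    by (rule complex_poly_decompose')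
  define c where "c = lead_coeff p"
  have poly_x: "poly p w = c * (\<Prod>i<degree p. w - x i)" for w
    by (subst x[symmetric]) (simp add: poly_prod c_def)
  have poly_nz: "poly p w \<noteq> 0" if "cmod w = 1" for w
    using poly_p[of w] z that by (force simp: image_iff)
  \<comment> \<open>Otherwise \<open>p\<close> would vanish identically, in particular at 1.\<close>
  have "c \<noteq> 0"
    using poly_nz[of 1] poly_x[of 1] by auto
  have x1: "cmod (x i) \<noteq> 1" if "i < degree p" for i
    using poly_nz[of "x i"] poly_x[of "x i"] that by auto
  have sym: "symbol k a w = z + c * (\<Prod>i<degree p. w - x i) / w ^ (k - 1)" if "cmod w = 1" for w
  proof -
    have "w \<noteq> 0"
      using that by auto
    thus ?thesis
      using poly_p[of w] unfolding poly_x by (simp add: field_simps)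
  qed
  have "winding_number (symbol k a \<circ> circlepath 0 1) z =
      of_nat (card {i\<in>{..<degree p}. cmod (x i) < 1}) - of_nat (k - 1)"
    by (rule winding_number_compose_factored[OF \<open>c \<noteq> 0\<close> x1 sym])
  hence "k \<le> card {i\<in>{..<degree p}. cmod (x i) < 1}"
    using ind by (simp add: circle_index_def)
  \<comment> \<open>Indices rather than values are chosen, so multiple zeros keep their
    multiplicity.\<close>
  then obtain J where J: "J \<subseteq> {i\<in>{..<degree p}. cmod (x i) < 1}" "card J = k"
    by (meson obtain_subset_with_card_n)
  hence fin: "finite J"
    using finite_subset by fastforce
  define xs where "xs = map x (sorted_list_of_set J)"
  have len: "length xs = k"
    using J by (simp add: xs_def)
  have "(\<Prod>y\<leftarrow>xs. [:- y, 1:]) = (\<Prod>i\<in>J. [:- x i, 1:])"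
    unfolding xs_def map_map using fin by (subst prod.distinct_set_conv_list[symmetric]) (auto simp: o_def)
  also have "\<dots> dvd (\<Prod>i<degree p. [:- x i, 1:])"
    using J by (intro prod_dvd_prod_subset) auto
  also have "\<dots> dvd p"
    by (metis x dvd_refl dvd_smult)
  finally have "(\<Prod>y\<leftarrow>xs. [:- y, 1:]) dvd p" .
  moreover have "cmod y < 1" if "y \<in> set xs" for y
    using that J fin by (auto simp: xs_def)
  ultimately obtain b where b: "\<And>s t. t < k \<Longrightarrow> b s t = of_bool (s = t)"
    "\<And>s. summable (\<lambda>t. cmod (b s t))" "\<And>s t. poly_shift p (b s) t = 0"
    using fundamental_solutions[of xs p] len by metis
  have "(\<Sum>l<2 * k - 1. e l * b s (t + l)) = 0" for s t
  proof -
    \<comment> \<open>One more than the largest exponent that occurs; the additional coefficient is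
      0.\<close>
    have "degree p \<le> 2 * k - 1"
      by (rule degree_le) (simp add: coeff_p)
    from poly_shift_eq_sum[OF this, of "b s" t] b(3)[of s t]
    have "(\<Sum>l<Suc (2 * k - 1). coeff p l * b s (t + l)) = 0"
      by (simp add: lessThan_Suc_atMost)
    thus ?thesis
      by (simp add: coeff_p)
  qed
  with b(1,2) show ?thesis
    by (rule that)
qed

section \<open>Localized pseudo-eigenvectors\<close>

text \<open>Gaussian elimination: a pivot in the last row is used to remove one unknown and one
  equation.\<close>

lemma exists_nontrivial_solution:
  fixes M :: "nat \<Rightarrow> 'b \<Rightarrow> 'a :: field"
  assumes "finite S" "m < card S"
  shows "\<exists>c. (\<exists>s\<in>S. c s \<noteq> 0) \<and> (\<forall>i<m. (\<Sum>s\<in>S. M i s * c s) = 0)"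
  using assms
proof (induction m arbitrary: S M)
  case 0
  hence "S \<noteq> {}"
    by auto
  thus ?case
    by (intro exI[of _ "\<lambda>_. 1"]) auto
next
  case (Suc m)
  show ?case
  proof (cases "\<forall>s\<in>S. M m s = 0")
    case True
    with Suc.IH[of S M] Suc.prems show ?thesis
      by (auto simp: less_Suc_eq)
  next
    case False
    then obtain p where p: "p \<in> S" "M m p \<noteq> 0"
      by auto
    let ?S = "S - {p}"
    have "m < card ?S"
      using Suc.prems p by simp
    then obtain c where c: "\<exists>s\<in>?S. c s \<noteq> 0"
      "\<And>i. i < m \<Longrightarrow> (\<Sum>s\<in>?S. (M i s - M i p * M m s / M m p) * c s) = 0"
      using Suc.IH[of ?S "\<lambda>i s. M i s - M i p * M m s / M m p"] Suc.prems by auto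
    \<comment> \<open>The value of the pivot unknown forced by row \<open>m\<close>.\<close>
    define y where "y = - (\<Sum>s\<in>?S. M m s * c s) / M m p"
    define d where "d = c(p := y)"
    have sum_d: "(\<Sum>s\<in>S. M i s * d s) = M i p * y + (\<Sum>s\<in>?S. M i s * c s)" for i
      using Suc.prems p by (simp add: sum.remove[of S p] d_def)
    have "(\<Sum>s\<in>S. M i s * d s) = 0" if "i < Suc m" for i
    proof (cases "i = m")
      case True
      thus ?thesis
        using p by (simp add: sum_d y_def)
    next
      case False
      hence "(\<Sum>s\<in>?S. M i s * c s) = (\<Sum>s\<in>?S. M i p * M m s / M m p * c s)"
        using c(2)[of i] that by (simp add: left_diff_distrib sum_subtractf)
      also have "\<dots> = M i p * ((\<Sum>s\<in>?S. M m s * c s) / M m p)"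
        by (simp add: sum_distrib_left sum_divide_distrib mult.assoc)
      finally show ?thesis
        by (simp add: sum_d y_def)
    qed
    moreover have "\<exists>s\<in>S. d s \<noteq> 0"
      using c(1) by (auto simp: d_def)
    ultimately show ?thesis
      by blast
  qed
qed

text \<open>Subtracting the vanishing sum of \<open>e l * w (t + l)\<close> leaves
  \<open>(R t l - e l) * w (t + l)\<close> before the cut and \<open>- e l * w (t + l)\<close> after
  it. Summed over \<open>t\<close>, these are controlled by the total and the tail of
  \<open>g\<close>, uniformly in \<open>T\<close>.\<close>

lemma truncated_recurrence_residual:
  fixes w :: "nat \<Rightarrow> complex" and R :: "nat \<Rightarrow> nat \<Rightarrow> complex"
  assumes w: "\<And>t. (\<Sum>l<p. e l * w (t + l)) = 0" "\<And>u. cmod (w u) \<le> \<nu> * g u"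
    and g: "summable g" "\<And>u. 0 \<le> g u"
    and R: "\<And>t l. l < p \<Longrightarrow> t + l < L \<Longrightarrow> cmod (R t l - e l) \<le> \<eta>"
    and "0 \<le> \<nu>" "0 \<le> \<eta>"
  shows "(\<Sum>t<T. cmod (\<Sum>l<p. R t l * (if t + l < L then w (t + l) else 0)))
           \<le> \<nu> * ((\<Sum>l<p. cmod (e l)) * (\<Sum>u. g (u + L)) + real p * \<eta> * suminf g)"
proof -
  \<comment> \<open>Its total is the tail of \<open>g\<close>, so shifted sums of the tail can be
    treated like those of \<open>g\<close>.\<close>
  define h where "h u = (if u < L then 0 else g u)" for u
  have sh: "summable (\<lambda>u. h (u + L))"
    using summable_ignore_initial_segment[OF g(1), of L] by (simp add: h_def)
  hence h: "summable h"
    by (rule summable_iff_shift[THEN iffD1])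
  have h_suminf: "suminf h = (\<Sum>u. g (u + L))"
    using suminf_split_initial_segment[OF h, of L] by (simp add: h_def)
  have h_nonneg: "0 \<le> h u" for u
    using g(2) by (simp add: h_def)
  have shifted: "(\<Sum>t<T. f (t + l)) \<le> suminf f" if "summable f" "\<And>u. 0 \<le> f u" for f :: "nat \<Rightarrow> real" and l
  proof -
    have "(\<Sum>t<T. f (t + l)) = (\<Sum>u\<in>(\<lambda>t. t + l) ` {..<T}. f u)"
      by (subst sum.reindex) auto
    also have "\<dots> \<le> suminf f"
      using that by (intro sum_le_suminf) auto
    finally show ?thesis .
  qed
  have row: "cmod (\<Sum>l<p. R t l * (if t + l < L then w (t + l) else 0))
      \<le> (\<Sum>l<p. cmod (e l) * (\<nu> * h (t + l)) + \<eta> * (\<nu> * g (t + l)))" for t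
  proof -
    have eq: "(\<Sum>l<p. R t l * (if t + l < L then w (t + l) else 0)) =
        (\<Sum>l<p. R t l * (if t + l < L then w (t + l) else 0) - e l * w (t + l))"
      by (simp add: sum_subtractf w(1))
    have "cmod (\<Sum>l<p. R t l * (if t + l < L then w (t + l) else 0)) \<le> (\<Sum>l<p. cmod (R t l * (if t + l < L then w (t + l) else 0) - e l * w (t + l)))"
      unfolding eq by (rule norm_sum)
    also have "\<dots> \<le> (\<Sum>l<p. cmod (e l) * (\<nu> * h (t + l)) + \<eta> * (\<nu> * g (t + l)))"
    proof (rule sum_mono)
      fix l assume "l \<in> {..<p}"
      show "cmod (R t l * (if t + l < L then w (t + l) else 0) - e l * w (t + l))
          \<le> cmod (e l) * (\<nu> * h (t + l)) + \<eta> * (\<nu> * g (t + l))"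
      proof (cases "t + l < L")
        case True
        hence "cmod ((R t l - e l) * w (t + l)) \<le> \<eta> * (\<nu> * g (t + l))"
          unfolding norm_mult using R[of l t] w(2)[of "t + l"] \<open>l \<in> _\<close> \<open>0 \<le> \<eta>\<close> by (intro mult_mono) auto
        with True show ?thesis
          by (simp add: h_def algebra_simps)
      next
        case False
        hence "cmod (e l * w (t + l)) \<le> cmod (e l) * (\<nu> * h (t + l))"
          unfolding norm_mult h_def using w(2)[of "t + l"] by (intro mult_left_mono) auto
        moreover have "0 \<le> \<eta> * (\<nu> * g (t + l))"
          using g(2) \<open>0 \<le> \<eta>\<close> \<open>0 \<le> \<nu>\<close> by simp
        ultimately show ?thesis
          using False by simp
      qed
    qed
    finally show ?thesis .
  qed
  have "(\<Sum>t<T. cmod (\<Sum>l<p. R t l * (if t + l < L then w (t + l) else 0)))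
      \<le> (\<Sum>t<T. \<Sum>l<p. cmod (e l) * (\<nu> * h (t + l)) + \<eta> * (\<nu> * g (t + l)))"
    by (intro sum_mono row)
  also have "\<dots> = (\<Sum>l<p. cmod (e l) * \<nu> * (\<Sum>t<T. h (t + l)) + \<eta> * \<nu> * (\<Sum>t<T. g (t + l)))"
    by (subst sum.swap) (simp add: sum.distrib sum_distrib_left mult.assoc)
  also have "\<dots> \<le> (\<Sum>l<p. cmod (e l) * \<nu> * suminf h + \<eta> * \<nu> * suminf g)"
    using \<open>0 \<le> \<eta>\<close> \<open>0 \<le> \<nu>\<close> g h h_nonneg
    by (intro sum_mono add_mono mult_left_mono shifted) auto
  also have "\<dots> = \<nu> * ((\<Sum>l<p. cmod (e l)) * suminf h + real p * \<eta> * suminf g)"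
    by (simp add: sum.distrib sum_distrib_left algebra_simps)
  finally show ?thesis
    unfolding h_suminf .
qed

text \<open>The order of choices matters: the solutions \<open>b\<close> and their majorant
  \<open>g\<close> come first, then \<open>\<eta>\<close> and \<open>m\<close>, and \<open>L\<close>
  from the tail of \<open>g\<close>. None of them depends on \<open>N\<close>.\<close>

lemma pseudo_eigenvectors_at_left_end:
  fixes A :: "nat \<Rightarrow> nat \<Rightarrow> nat \<Rightarrow> complex" and a :: "int \<Rightarrow> complex"
  assumes "0 < k" and z: "z \<notin> symbol k a ` sphere 0 1" "circle_index (symbol k a) 1 z > 0"
    and band: "\<And>N i j. i \<in> {1..N} \<Longrightarrow> j \<in> {1..N} \<Longrightarrow> int k \<le> \<bar>int i - int j\<bar> \<Longrightarrow> A N i j = 0"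
    and conv: "\<And>\<eta>. 0 < \<eta> \<Longrightarrow> \<exists>m. \<forall>N i j. m \<le> i \<longrightarrow> m \<le> j \<longrightarrow> i + m \<le> N \<longrightarrow> j + m \<le> N \<longrightarrow>
      \<bar>int i - int j\<bar> < int k \<longrightarrow> cmod (A N i j - a (int j - int i)) \<le> \<eta>"
    and "0 < err"
  shows "\<exists>L N0. \<forall>N\<ge>N0. \<exists>v. (\<forall>j. j \<notin> {1..L} \<longrightarrow> v j = 0) \<and>
    L2_set (\<lambda>j. cmod (v j)) {1..N} = 1 \<and> residual N (A N) z v < err"
proof -
  \<comment> \<open>A bulk row of the shifted Toeplitz matrix, read from the left edge of the band;
    the diagonal sits at position \<open>k - 1\<close>.\<close>
  define e where "e l = a (int l - (int k - 1)) - (if l = k - 1 then z else 0)" for l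
  obtain b where b: "\<And>s t. t < k \<Longrightarrow> b s t = of_bool (s = t)"
    "\<And>s. summable (\<lambda>t. cmod (b s t))" "\<And>s t. (\<Sum>l<2 * k - 1. e l * b s (t + l)) = 0"
    by (rule symbol_fundamental_solutions[OF \<open>0 < k\<close> z, folded e_def]) blast
  define g where "g u = (\<Sum>s<k. cmod (b s u))" for u
  have g: "summable g" "\<And>u. 0 \<le> g u"
    unfolding g_def by (auto intro!: summable_sum b(2) sum_nonneg)
  define E where "E = (\<Sum>l<2 * k - 1. cmod (e l))"
  define G where "G = real (2 * k - 1) * suminf g"
  have E: "0 \<le> E" and G: "0 \<le> G"
    using g by (auto simp: E_def G_def intro!: sum_nonneg suminf_nonneg mult_nonneg_nonneg)
  \<comment> \<open>Half of \<open>err\<close> is reserved for the deviation from Toeplitz form, the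
    other half for truncation; \<open>G + 1\<close> avoids division by 0.\<close>
  define \<eta> where "\<eta> = err / (2 * (G + 1))"
  have \<eta>: "0 < \<eta>" "G * \<eta> < err / 2"
    using G \<open>0 < err\<close> by (auto simp: \<eta>_def field_simps)
  obtain m where m: "\<And>N i j. m \<le> i \<Longrightarrow> m \<le> j \<Longrightarrow> i + m \<le> N \<Longrightarrow> j + m \<le> N \<Longrightarrow>
      \<bar>int i - int j\<bar> < int k \<Longrightarrow> cmod (A N i j - a (int j - int i)) \<le> \<eta>"
    using conv[OF \<eta>(1)] by blast
  have "0 < err / (2 * (E + 1))"
    using E \<open>0 < err\<close> by simp
  then obtain L0 where L0: "\<And>n. L0 \<le> n \<Longrightarrow> norm (\<Sum>u. g (u + n)) < err / (2 * (E + 1))"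
    using suminf_exist_split[OF _ g(1)] by blast
  \<comment> \<open>At least \<open>k\<close>, so that all initial values survive the
    truncation.\<close>
  define L where "L = max L0 k"
  have "k \<le> L" and tail: "(\<Sum>u. g (u + L)) < err / (2 * (E + 1))"
    using L0[of L] by (auto simp: L_def)
  have tail: "E * (\<Sum>u. g (u + L)) \<le> err / 2"
  proof -
    have "E * (\<Sum>u. g (u + L)) \<le> E * (err / (2 * (E + 1)))"
      using tail E by (intro mult_left_mono) auto
    also have "\<dots> \<le> err / 2"
      using E \<open>0 < err\<close> by (simp add: field_simps)
    finally show ?thesis .
  qed
  show ?thesis
  proof (rule exI[of _ "m + L"], rule exI[of _ "2 * m + L + k"], intro allI impI)
    \<comment> \<open>The rows whose band meets the window end at \<open>m + L + k - 1\<close>, so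
      they stay at distance at least \<open>m\<close> from the right end.\<close>
    fix N assume N: "2 * m + L + k \<le> N"
    define B where "B i j = A N i j - (if i = j then z else 0)" for i j
    \<comment> \<open>Unit vectors for \<open>s \<le> m\<close>, then the \<open>k\<close>
      solutions, started at column \<open>m + 1\<close> and cut off after \<open>L\<close>
      entries.\<close>
    define \<beta> where "\<beta> s j = (if s \<le> m then of_bool (j = s)
      else if m < j \<and> j \<le> m + L then b (s - m - 1) (j - m - 1) else 0)" for s j
    obtain c where c: "\<exists>s\<in>{1..m + k}. c s \<noteq> 0"
      "\<And>i. i < m + k - 1 \<Longrightarrow> (\<Sum>s\<in>{1..m + k}. (\<Sum>j\<in>{1..N}. B (Suc i) j * \<beta> s j) * c s) = 0"
      using exists_nontrivial_solution[of "{1..m + k}" "m + k - 1"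
          "\<lambda>i s. \<Sum>j\<in>{1..N}. B (Suc i) j * \<beta> s j"] \<open>0 < k\<close> by auto
    define v where "v j = (\<Sum>s\<in>{1..m + k}. c s * \<beta> s j)" for j
    define w where "w u = (\<Sum>s<k. c (m + 1 + s) * b s u)" for u
    define \<nu> where "\<nu> = L2_set (\<lambda>j. cmod (v j)) {1..N}"
    \<comment> \<open>On the first \<open>m + k\<close> positions the vectors
      \<open>\<beta> s\<close> are unit vectors, so the coefficients are entries of \<open>v\<close>
      and are bounded by its norm \<open>\<nu>\<close>.\<close>
    have v_initial: "v s = c s" if "s \<in> {1..m + k}" for s
    proof -
      have "\<beta> s' s = of_bool (s' = s)" if "s' \<in> {1..m + k}" for s'
        using that \<open>s \<in> _\<close> \<open>k \<le> L\<close> b(1)[of "s - m - 1" "s' - m - 1"] by (auto simp: \<beta>_def)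
      hence "v s = (\<Sum>s'\<in>{1..m + k}. if s' = s then c s' else 0)"
        unfolding v_def by (intro sum.cong) auto
      thus ?thesis
        using that by simp
    qed
    have v_support: "v j = 0" if "j \<notin> {1..m + L}" for j
      unfolding v_def using that by (intro sum.neutral) (auto simp: \<beta>_def)
    have v_tail: "v (m + 1 + u) = (if u < L then w u else 0)" for u
    proof (cases "u < L")
      case True
      have "v (m + 1 + u) = (\<Sum>s\<in>{m + 1..m + k}. c s * \<beta> s (m + 1 + u))"
        unfolding v_def by (intro sum.mono_neutral_right) (auto simp: \<beta>_def)
      also have "\<dots> = w u"
        unfolding w_def using True
        by (intro sum.reindex_bij_witness[of _ "\<lambda>s. m + 1 + s" "\<lambda>s. s - (m + 1)"]) (auto simp: \<beta>_def)
      finally show ?thesis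
        using True by simp
    qed (simp add: v_support)
    have c_le: "cmod (c s) \<le> \<nu>" if "s \<in> {1..m + k}" for s
      unfolding \<nu>_def v_initial[OF that, symmetric]
      using that N \<open>k \<le> L\<close> by (intro member_le_L2_set) auto
    have "\<nu> > 0"
    proof -
      obtain s where "s \<in> {1..m + k}" "c s \<noteq> 0"
        using c(1) by blast
      thus ?thesis
        using c_le[of s] by (smt (verit) zero_less_norm_iff)
    qed
    have w_le: "cmod (w u) \<le> \<nu> * g u" for u
    proof -
      have "cmod (w u) \<le> (\<Sum>s<k. cmod (c (m + 1 + s) * b s u))"
        unfolding w_def by (rule norm_sum)
      also have "\<dots> \<le> (\<Sum>s<k. \<nu> * cmod (b s u))"
        unfolding norm_mult by (intro sum_mono mult_right_mono c_le) auto
      finally show ?thesis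
        by (simp add: g_def sum_distrib_left)
    qed
    have w_rec: "(\<Sum>l<2 * k - 1. e l * w (t + l)) = 0" for t
    proof -
      have "(\<Sum>l<2 * k - 1. e l * w (t + l)) = (\<Sum>l<2 * k - 1. \<Sum>s<k. c (m + 1 + s) * (e l * b s (t + l)))"
        by (simp add: w_def sum_distrib_left mult_ac)
      also have "\<dots> = (\<Sum>s<k. c (m + 1 + s) * (\<Sum>l<2 * k - 1. e l * b s (t + l)))"
        by (subst sum.swap) (simp add: sum_distrib_left)
      finally show ?thesis
        by (simp only: b(3) mult_zero_right sum.neutral_const)
    qed
    have row_head: "(\<Sum>j\<in>{1..N}. B i j * v j) = 0" if "i \<in> {1..<m + k}" for i
    proof -
      have "(\<Sum>j\<in>{1..N}. B i j * v j) = (\<Sum>j\<in>{1..N}. \<Sum>s\<in>{1..m + k}. B i j * \<beta> s j * c s)"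
        by (simp add: v_def sum_distrib_left mult_ac)
      also have "\<dots> = (\<Sum>s\<in>{1..m + k}. (\<Sum>j\<in>{1..N}. B i j * \<beta> s j) * c s)"
        by (subst sum.swap) (simp add: sum_distrib_right)
      also have "\<dots> = 0"
        using c(2)[of "i - 1"] that by auto
      finally show ?thesis .
    qed
    \<comment> \<open>The band of row \<open>m + k + t\<close> starts at column
      \<open>m + 1 + t\<close>: from row \<open>m + k\<close> on, the free entries are no longer
      seen.\<close>
    define R where "R t l = B (m + k + t) (m + 1 + (t + l))" for t l
    have row_tail: "(\<Sum>j\<in>{1..N}. B (m + k + t) j * v j) =
        (\<Sum>l<2 * k - 1. R t l * (if t + l < L then w (t + l) else 0))" if t: "m + k + t \<le> N" for t
    proof -
      let ?i = "m + k + t"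
      have "(\<Sum>j\<in>{1..N}. B ?i j * v j) = (\<Sum>j\<in>{m + 1 + t..<m + 1 + t + (2 * k - 1)}. B ?i j * v j)"
      proof (rule sum.mono_neutral_cong)
        fix j assume "j \<in> {1..N} - {m + 1 + t..<m + 1 + t + (2 * k - 1)}"
        hence "A N ?i j = 0" "?i \<noteq> j"
          using band[of ?i N j] t \<open>0 < k\<close> by (auto split: abs_split)
        thus "B ?i j * v j = 0"
          by (simp add: B_def)
      next
        \<comment> \<open>The full band may stick out beyond column \<open>N\<close>, where
          \<open>v\<close> is 0.\<close>
        fix j assume "j \<in> {m + 1 + t..<m + 1 + t + (2 * k - 1)} - {1..N}"
        thus "B ?i j * v j = 0"
          using v_support[of j] N by auto
      qed auto
      also have "\<dots> = (\<Sum>l<2 * k - 1. B ?i (m + 1 + t + l) * v (m + 1 + t + l))"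
        by (intro sum.reindex_bij_witness[of _ "\<lambda>l. m + 1 + t + l" "\<lambda>j. j - (m + 1 + t)"]) auto
      also have "\<dots> = (\<Sum>l<2 * k - 1. R t l * (if t + l < L then w (t + l) else 0))"
        unfolding R_def v_tail[symmetric] by (simp add: add_ac)
      finally show ?thesis .
    qed
    have R_le: "cmod (R t l - e l) \<le> \<eta>" if "l < 2 * k - 1" "t + l < L" for t l
    proof -
      have "R t l - e l = A N (m + k + t) (m + 1 + (t + l)) - a (int (m + 1 + (t + l)) - int (m + k + t))"
        using \<open>0 < k\<close> by (auto simp: R_def B_def e_def algebra_simps)
      also have "cmod \<dots> \<le> \<eta>"
        by (rule m) (use that N \<open>k \<le> L\<close> in auto)
      finally show ?thesis .
    qed
    \<comment> \<open>The Euclidean norm is bounded by the sum of the moduli, to which the estimate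
      for the truncated recurrence applies.\<close>
    have "residual N (A N) z v \<le> (\<Sum>i\<in>{1..N}. cmod (\<Sum>j\<in>{1..N}. B i j * v j))"
      unfolding residual_def B_def by (rule L2_set_le_sum) simp
    also have "\<dots> = (\<Sum>i\<in>{m + k..N}. cmod (\<Sum>j\<in>{1..N}. B i j * v j))"
      using row_head \<open>0 < k\<close> by (intro sum.mono_neutral_right) auto
    also have "\<dots> = (\<Sum>t<N + 1 - (m + k). cmod (\<Sum>j\<in>{1..N}. B (m + k + t) j * v j))"
      by (intro sum.reindex_bij_witness[of _ "\<lambda>t. m + k + t" "\<lambda>i. i - (m + k)"]) auto
    also have "\<dots> = (\<Sum>t<N + 1 - (m + k).
        cmod (\<Sum>l<2 * k - 1. R t l * (if t + l < L then w (t + l) else 0)))"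
      by (intro sum.cong refl arg_cong[of _ _ cmod] row_tail) auto
    also have "\<dots> \<le> \<nu> * ((\<Sum>l<2 * k - 1. cmod (e l)) * (\<Sum>u. g (u + L)) + real (2 * k - 1) * \<eta> * suminf g)"
      by (rule truncated_recurrence_residual[where w = w and g = g and e = e])
        (use w_rec w_le g R_le \<open>\<nu> > 0\<close> \<eta>(1) in auto)
    also have "\<dots> = \<nu> * (E * (\<Sum>u. g (u + L)) + G * \<eta>)"
      by (simp add: E_def G_def mult_ac)
    also have "\<dots> < \<nu> * err"
      using tail \<eta>(2) \<open>\<nu> > 0\<close> by simp
    finally have res: "residual N (A N) z v < \<nu> * err" .
    define x where "x j = v j / of_real \<nu>" for j
    have "L2_set (\<lambda>j. cmod (x j)) {1..N} = L2_set (\<lambda>j. 1 / \<nu> * cmod (v j)) {1..N}"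
      using \<open>\<nu> > 0\<close> by (simp add: x_def norm_divide)
    also have "\<dots> = 1 / \<nu> * L2_set (\<lambda>j. cmod (v j)) {1..N}"
      using \<open>\<nu> > 0\<close> by (intro L2_set_right_distrib[symmetric]) simp
    also have "\<dots> = 1"
      unfolding \<nu>_def[symmetric] using \<open>\<nu> > 0\<close> by simp
    finally have "L2_set (\<lambda>j. cmod (x j)) {1..N} = 1" .
    moreover have "residual N (A N) z x = 1 / \<nu> * residual N (A N) z v"
      unfolding residual_def x_def using \<open>\<nu> > 0\<close>
      by (subst L2_set_right_distrib) (auto simp: norm_divide simp flip: sum_divide_distrib)
    hence "residual N (A N) z x < err"
      using res \<open>\<nu> > 0\<close> by (simp add: pos_divide_less_eq mult.commute)
    moreover have "\<forall>j. j \<notin> {1..m + L} \<longrightarrow> x j = 0"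
      using v_support by (simp add: x_def)
    ultimately show "\<exists>v. (\<forall>j. j \<notin> {1..m + L} \<longrightarrow> v j = 0) \<and>
        L2_set (\<lambda>j. cmod (v j)) {1..N} = 1 \<and> residual N (A N) z v < err"
      by blast
  qed
qed

section \<open>Reversing the order of the indices\<close>

lemma circle_index_symbol_reflect:
  assumes "z \<notin> symbol k a ` sphere 0 1"
  shows "symbol k (\<lambda>j. a (- j)) ` sphere 0 1 = symbol k a ` sphere 0 1"
    and "circle_index (symbol k (\<lambda>j. a (- j))) 1 z = - circle_index (symbol k a) 1 z"
proof -
  \<comment> \<open>Reversing the coefficients substitutes \<open>inverse w\<close>, which on the
    unit circle reverses the orientation and hence the sign of the index.\<close>
  have inv: "symbol k (\<lambda>j. a (- j)) w = symbol k a (inverse w)" for w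
    unfolding symbol_def
    by (intro sum.reindex_bij_witness[of _ uminus uminus]) (auto simp: power_int_minus power_int_inverse)
  have "inverse ` sphere (0 :: complex) 1 = sphere 0 1"
  proof
    show "sphere (0 :: complex) 1 \<subseteq> inverse ` sphere 0 1"
      by (auto intro!: image_eqI[of _ _ "inverse _"] simp: norm_inverse)
  qed (auto simp: norm_inverse)
  thus "symbol k (\<lambda>j. a (- j)) ` sphere 0 1 = symbol k a ` sphere 0 1"
    by (metis (no_types, lifting) image_cong image_image inv)
  let ?\<gamma> = "circlepath (0 :: complex) 1"
  have rev: "symbol k (\<lambda>j. a (- j)) \<circ> ?\<gamma> = reversepath (symbol k a \<circ> ?\<gamma>)"
  proof
    fix t
    have "?\<gamma> (1 - t) = inverse (?\<gamma> t)"
      by (simp add: circlepath right_diff_distrib exp_diff exp_minus divide_inverse)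
    thus "(symbol k (\<lambda>j. a (- j)) \<circ> ?\<gamma>) t = reversepath (symbol k a \<circ> ?\<gamma>) t"
      by (simp add: reversepath_def inv)
  qed
  have "path (symbol k a \<circ> ?\<gamma>)"
    unfolding symbol_def
    by (rule path_continuous_image) (auto intro!: continuous_intros)
  moreover have "z \<notin> path_image (symbol k a \<circ> ?\<gamma>)"
    using assms by (simp add: path_image_compose)
  ultimately show "circle_index (symbol k (\<lambda>j. a (- j))) 1 z = - circle_index (symbol k a) 1 z"
    unfolding circle_index_def rev by (simp add: winding_number_reversepath)
qed

lemma L2_set_reflect: "L2_set (\<lambda>j. h (N + 1 - j)) {1..N} = L2_set h {1..N}" for N :: nat
  unfolding L2_set_def
  by (intro arg_cong[of _ _ sqrt] sum.reindex_bij_witness[of _ "\<lambda>j. N + 1 - j" "\<lambda>j. N + 1 - j"]) auto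

lemma residual_reflect:
  "residual N (\<lambda>i j. A (N + 1 - i) (N + 1 - j)) z (\<lambda>j. v (N + 1 - j)) = residual N A z v"
proof -
  define g where "g i = cmod (\<Sum>j\<in>{1..N}. (A i j - (if i = j then z else 0)) * v j)" for i
  have "cmod (\<Sum>j\<in>{1..N}. (A (N + 1 - i) (N + 1 - j) - (if i = j then z else 0)) * v (N + 1 - j)) =
      g (N + 1 - i)" if "i \<in> {1..N}" for i
    unfolding g_def
    by (intro arg_cong[of _ _ cmod] sum.reindex_bij_witness[of _ "\<lambda>j. N + 1 - j" "\<lambda>j. N + 1 - j"])
      (use that in auto)
  hence "residual N (\<lambda>i j. A (N + 1 - i) (N + 1 - j)) z (\<lambda>j. v (N + 1 - j)) =
      L2_set (\<lambda>i. g (N + 1 - i)) {1..N}"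
    unfolding residual_def by (intro L2_set_cong) auto
  also have "\<dots> = L2_set g {1..N}"
    by (rule L2_set_reflect)
  also have "\<dots> = residual N A z v"
    unfolding residual_def g_def ..
  finally show ?thesis .
qed

text \<open>The ratio is at most 1, and it is nonzero only where \<open>d \<le> L\<close>; there the
  constant \<open>(1 / \<rho>) ^ L\<close> outweighs \<open>\<rho> ^ d\<close>.\<close>

lemma normalized_decay:
  fixes v :: "nat \<Rightarrow> complex"
  assumes "0 < \<rho>" "\<rho> < 1" "j \<in> {1..N}" and d: "v j \<noteq> 0 \<Longrightarrow> d \<le> L"
  shows "cmod (v j) / Max ((\<lambda>j. cmod (v j)) ` {1..N}) \<le> (1 / \<rho>) ^ L * \<rho> ^ d"
proof (cases "v j = 0")
  case False
  have "cmod (v j) \<le> Max ((\<lambda>j. cmod (v j)) ` {1..N})"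
    using assms by (intro Max_ge) auto
  moreover have "0 < cmod (v j)"
    using False by simp
  ultimately have "cmod (v j) / Max ((\<lambda>j. cmod (v j)) ` {1..N}) \<le> 1"
    by (subst divide_le_eq_1_pos) linarith+
  also have "1 \<le> \<rho> ^ d / \<rho> ^ L"
    using assms d False by (simp add: power_decreasing)
  finally show ?thesis
    by (simp add: power_one_over field_simps)
qed (use assms in simp)

lemma localized_of_band_convergence:
  fixes A :: "nat \<Rightarrow> nat \<Rightarrow> nat \<Rightarrow> complex" and a :: "int \<Rightarrow> complex"
  assumes "0 < k" and z: "z \<notin> symbol k a ` sphere 0 1" "circle_index (symbol k a) 1 z \<noteq> 0"
    and band: "\<And>N i j. i \<in> {1..N} \<Longrightarrow> j \<in> {1..N} \<Longrightarrow> int k \<le> \<bar>int i - int j\<bar> \<Longrightarrow> A N i j = 0"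
    and conv: "\<And>\<eta>. 0 < \<eta> \<Longrightarrow> \<exists>m. \<forall>N i j. m \<le> i \<longrightarrow> m \<le> j \<longrightarrow> i + m \<le> N \<longrightarrow> j + m \<le> N \<longrightarrow>
      \<bar>int i - int j\<bar> < int k \<longrightarrow> cmod (A N i j - a (int j - int i)) \<le> \<eta>"
    and "0 < err" "0 < \<rho>" "\<rho> < 1"
  shows "localized_pseudo_eigenvectors A k (symbol k a) z err \<rho>"
proof (cases "circle_index (symbol k a) 1 z > 0")
  case True
  have "\<exists>L N0. \<forall>N\<ge>N0. \<exists>v. (\<forall>j. j \<notin> {1..L} \<longrightarrow> v j = 0) \<and>
      L2_set (\<lambda>j. cmod (v j)) {1..N} = 1 \<and> residual N (A N) z v < err"
    by (rule pseudo_eigenvectors_at_left_end[OF \<open>0 < k\<close> z(1) True band conv \<open>0 < err\<close>])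
  then obtain L N0 where *: "\<forall>N\<ge>N0. \<exists>v. (\<forall>j. j \<notin> {1..L} \<longrightarrow> v j = 0) \<and>
      L2_set (\<lambda>j. cmod (v j)) {1..N} = 1 \<and> residual N (A N) z v < err"
    by (elim exE)
  show ?thesis
    unfolding localized_pseudo_eigenvectors_def
  \<comment> \<open>The residual is already below \<open>err\<close>, so \<open>C1\<close> and
    \<open>C2\<close> can be 0.\<close>
  proof (rule exI[of _ 0], rule exI[of _ 0], rule exI[of _ "(1 / \<rho>) ^ L"], rule exI[of _ N0], intro allI impI)
    fix N assume "N0 \<le> N"
    then obtain v where v: "\<And>j. j \<notin> {1..L} \<Longrightarrow> v j = 0" "L2_set (\<lambda>j. cmod (v j)) {1..N} = 1"
        "residual N (A N) z v < err"
      using * by blast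
    have "cmod (v j) / Max ((\<lambda>j. cmod (v j)) ` {1..N}) \<le> (1 / \<rho>) ^ L * \<rho> ^ (j - 1)" if "j \<in> {1..N}" for j
      using v(1)[of j] that \<open>0 < \<rho>\<close> \<open>\<rho> < 1\<close> by (intro normalized_decay) fastforce+
    thus "\<exists>v. L2_set (\<lambda>j. cmod (v j)) {1..N} = 1 \<and>
        residual N (A N) z v < max 0 (0 * real N ^ (k - 1)) * \<rho> ^ (N - 2 * k + 2) + err \<and>
        (\<forall>j\<in>{1..N}.
          (circle_index (symbol k a) 1 z > 0 \<longrightarrow>
            cmod (v j) / Max ((\<lambda>j. cmod (v j)) ` {1..N}) \<le> (1 / \<rho>) ^ L * \<rho> ^ (j - 1)) \<and>
          (circle_index (symbol k a) 1 z < 0 \<longrightarrow>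
            cmod (v j) / Max ((\<lambda>j. cmod (v j)) ` {1..N}) \<le> (1 / \<rho>) ^ L * \<rho> ^ (N - j)))"
      using v True by (intro exI[of _ v]) auto
  qed
next
  case False
  define a' where "a' j = a (- j)" for j
  define A' where "A' N i j = A N (N + 1 - i) (N + 1 - j)" for N i j
  have z': "z \<notin> symbol k a' ` sphere 0 1" "circle_index (symbol k a') 1 z > 0"
    using circle_index_symbol_reflect[OF z(1)] z False by (auto simp: a'_def[abs_def])
  have band': "A' N i j = 0" if "i \<in> {1..N}" "j \<in> {1..N}" "int k \<le> \<bar>int i - int j\<bar>" for N i j
    unfolding A'_def by (rule band) (use that in auto)
  have conv': "\<exists>m. \<forall>N i j. m \<le> i \<longrightarrow> m \<le> j \<longrightarrow> i + m \<le> N \<longrightarrow> j + m \<le> N \<longrightarrow>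
      \<bar>int i - int j\<bar> < int k \<longrightarrow> cmod (A' N i j - a' (int j - int i)) \<le> \<eta>" if "0 < \<eta>" for \<eta>
  proof -
    obtain m where m: "\<And>N i j. m \<le> i \<Longrightarrow> m \<le> j \<Longrightarrow> i + m \<le> N \<Longrightarrow> j + m \<le> N \<Longrightarrow>
        \<bar>int i - int j\<bar> < int k \<Longrightarrow> cmod (A N i j - a (int j - int i)) \<le> \<eta>"
      using conv[OF \<open>0 < \<eta>\<close>] by blast
    \<comment> \<open>The margin grows by one: \<open>N + 1 - i + m \<le> N\<close> amounts to
      \<open>m + 1 \<le> i\<close>.\<close>
    have "cmod (A' N i j - a' (int j - int i)) \<le> \<eta>"
      if "m + 1 \<le> i" "m + 1 \<le> j" "i + (m + 1) \<le> N" "j + (m + 1) \<le> N" "\<bar>int i - int j\<bar> < int k" for N i j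
    proof -
      have eq: "a' (int j - int i) = a (int (N + 1 - j) - int (N + 1 - i))"
        using that by (simp add: a'_def of_nat_diff)
      show ?thesis
        unfolding A'_def eq by (rule m) (use that in auto)
    qed
    thus ?thesis
      by blast
  qed
  have "\<exists>L N0. \<forall>N\<ge>N0. \<exists>v. (\<forall>j. j \<notin> {1..L} \<longrightarrow> v j = 0) \<and>
      L2_set (\<lambda>j. cmod (v j)) {1..N} = 1 \<and> residual N (A' N) z v < err"
    by (rule pseudo_eigenvectors_at_left_end[OF \<open>0 < k\<close> z' band' conv' \<open>0 < err\<close>])
  then obtain L N0 where *: "\<forall>N\<ge>N0. \<exists>v. (\<forall>j. j \<notin> {1..L} \<longrightarrow> v j = 0) \<and>
      L2_set (\<lambda>j. cmod (v j)) {1..N} = 1 \<and> residual N (A' N) z v < err"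
    by (elim exE)
  show ?thesis
    unfolding localized_pseudo_eigenvectors_def
  proof (rule exI[of _ 0], rule exI[of _ 0], rule exI[of _ "(1 / \<rho>) ^ L"], rule exI[of _ N0], intro allI impI)
    fix N assume "N0 \<le> N"
    then obtain u where u: "\<And>j. j \<notin> {1..L} \<Longrightarrow> u j = 0" "L2_set (\<lambda>j. cmod (u j)) {1..N} = 1"
        "residual N (A' N) z u < err"
      using * by blast
    define v where "v j = u (N + 1 - j)" for j
    have norm_v: "L2_set (\<lambda>j. cmod (v j)) {1..N} = 1"
      unfolding v_def using L2_set_reflect[of "\<lambda>j. cmod (u j)" N] u(2) by simp
    \<comment> \<open>Reflecting twice returns \<open>u\<close> on \<open>{1..N}\<close> only,
      because subtraction is truncated.\<close>
    have "residual N (A' N) z u = residual N (A' N) z (\<lambda>j. v (N + 1 - j))"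
      unfolding residual_def by (intro L2_set_cong arg_cong[of _ _ cmod] sum.cong) (auto simp: v_def)
    also have "\<dots> = residual N (A N) z v"
      unfolding A'_def by (rule residual_reflect)
    finally have res_v: "residual N (A N) z v < err"
      using u(3) by simp
    have "cmod (v j) / Max ((\<lambda>j. cmod (v j)) ` {1..N}) \<le> (1 / \<rho>) ^ L * \<rho> ^ (N - j)" if "j \<in> {1..N}" for j
      using u(1)[of "N + 1 - j"] that \<open>0 < \<rho>\<close> \<open>\<rho> < 1\<close>
      by (intro normalized_decay) (fastforce simp: v_def)+
    thus "\<exists>v. L2_set (\<lambda>j. cmod (v j)) {1..N} = 1 \<and>
        residual N (A N) z v < max 0 (0 * real N ^ (k - 1)) * \<rho> ^ (N - 2 * k + 2) + err \<and>
        (\<forall>j\<in>{1..N}.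
          (circle_index (symbol k a) 1 z > 0 \<longrightarrow>
            cmod (v j) / Max ((\<lambda>j. cmod (v j)) ` {1..N}) \<le> (1 / \<rho>) ^ L * \<rho> ^ (j - 1)) \<and>
          (circle_index (symbol k a) 1 z < 0 \<longrightarrow>
            cmod (v j) / Max ((\<lambda>j. cmod (v j)) ` {1..N}) \<le> (1 / \<rho>) ^ L * \<rho> ^ (N - j)))"
      using norm_v res_v False by (intro exI[of _ v]) auto
  qed
qed

section \<open>Application to the gauge capacitance matrices\<close>

theorem theorem6p1:
  fixes D :: "(real^3) set" and s \<gamma> \<delta> K \<epsilon> :: real
  assumes D_domain: "open D" "D \<noteq> {}" "bounded D" "simply_connected D"
    and D_regular: "0 < s" "s < 1" "C1s_boundary s D"
    and D_strip: "\<forall>x\<in>D. 0 \<le> x $ 1 \<and> x $ 1 < 1"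
    and D_disjoint: "\<forall>i j. i \<noteq> j \<longrightarrow> closure (resonator D i) \<inter> closure (resonator D j) = {}"
    and params: "\<gamma> \<noteq> 0" "\<delta> > 0"
    and K_pos: "K > 0"
    and K_bound: "\<forall>N. \<forall>i\<in>{1..N}. \<forall>j\<in>{1..N}.
      cmod (cap_matrix D \<gamma> \<delta> N i j - cap_infinite D \<gamma> \<delta> (int i) (int j))
        \<le> \<delta> * K / ((1 + real (min i (N - i))) * (1 + real (min j (N - j))))"
    and eps: "\<epsilon> > 0"
  shows "(\<exists>k. band_width_ok \<epsilon> k) \<and>
    (\<forall>k a f z.
       band_width_ok \<epsilon> k \<longrightarrow>
       (\<forall>i j. \<bar>i - j\<bar> < int k \<longrightarrow> a (j - i) = cap_infinite D \<gamma> \<delta> i j) \<longrightarrow>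
       f = symbol k a \<longrightarrow>
       z \<notin> f ` sphere 0 1 \<longrightarrow> circle_index f 1 z \<noteq> 0 \<longrightarrow>
       (\<exists>\<rho>. 0 < \<rho> \<and> \<rho> < 1 \<and>
          localized_pseudo_eigenvectors (\<lambda>N. banded_cap_matrix D \<gamma> \<delta> N k) k f z
            (\<delta> * K * sqrt (10 * \<epsilon>)) \<rho>) \<and>
       (\<forall>\<rho> r.
          (0 < r \<and> r \<le> \<rho> \<and> \<rho> < 1 \<and> z \<notin> f ` sphere 0 r \<and> circle_index f r z > 0) \<or>
          (1 / \<rho> \<ge> 1 / r \<and> 1 / r > 1 \<and> z \<notin> f ` sphere 0 (1 / r) \<and> circle_index f (1 / r) z < 0)
          \<longrightarrow>
          localized_pseudo_eigenvectors (\<lambda>N. banded_cap_matrix D \<gamma> \<delta> N k) k f z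
            (\<delta> * K * sqrt (10 * \<epsilon>)) \<rho>))"
proof (intro conjI allI impI)
  show "\<exists>k. band_width_ok \<epsilon> k"
    using eps by (rule exists_band_width)
next
  fix k a f z
  assume ok: "band_width_ok \<epsilon> k"
    and a: "\<forall>i j. \<bar>i - j\<bar> < int k \<longrightarrow> a (j - i) = cap_infinite D \<gamma> \<delta> i j"
    and f: "f = symbol k a" and z: "z \<notin> f ` sphere 0 1" "circle_index f 1 z \<noteq> 0"
  let ?A = "\<lambda>N. banded_cap_matrix D \<gamma> \<delta> N k"
  have k: "0 < k"
    using ok by (simp add: band_width_ok_def)
  have band: "?A N i j = 0" if "int k \<le> \<bar>int i - int j\<bar>" for N i j
    using that by (simp add: banded_cap_matrix_def)
  have conv: "\<exists>m. \<forall>N i j. m \<le> i \<longrightarrow> m \<le> j \<longrightarrow> i + m \<le> N \<longrightarrow> j + m \<le> N \<longrightarrow>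
      \<bar>int i - int j\<bar> < int k \<longrightarrow> cmod (?A N i j - a (int j - int i)) \<le> \<eta>" if "0 < \<eta>" for \<eta>
  proof -
    obtain m where m: "\<delta> * K / \<eta> < real m"
      using reals_Archimedean2 by blast
    moreover have "0 < \<delta> * K / \<eta>"
      using params K_pos that by simp
    \<comment> \<open>Ensures that row and column indices at distance \<open>m\<close> from the ends
      lie in \<open>{1..N}\<close>, as \<open>K_bound\<close> requires.\<close>
    ultimately have "1 \<le> m"
      by (cases m) auto
    have "cmod (?A N i j - a (int j - int i)) \<le> \<eta>"
      if ij: "m \<le> i" "m \<le> j" "i + m \<le> N" "j + m \<le> N" "\<bar>int i - int j\<bar> < int k" for N i j
    proof -
      have "cmod (?A N i j - a (int j - int i)) =
          cmod (cap_matrix D \<gamma> \<delta> N i j - cap_infinite D \<gamma> \<delta> (int i) (int j))"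
        using ij a by (simp add: banded_cap_matrix_def)
      also have "\<dots> \<le> \<delta> * K / ((1 + real (min i (N - i))) * (1 + real (min j (N - j))))"
        using K_bound ij \<open>1 \<le> m\<close> by auto
      \<comment> \<open>The row factor is at least \<open>m\<close> and the column factor at least
        1, which already gives decay in \<open>m\<close>.\<close>
      also have "\<dots> \<le> \<delta> * K / (real m * 1)"
        using ij params K_pos \<open>1 \<le> m\<close> by (intro divide_left_mono mult_mono mult_pos_pos) auto
      also have "\<dots> \<le> \<eta>"
        using m \<open>1 \<le> m\<close> \<open>0 < \<eta>\<close> by (simp add: field_simps)
      finally show ?thesis .
    qed
    thus ?thesis
      by blast
  qed
  have loc: "localized_pseudo_eigenvectors ?A k f z (\<delta> * K * sqrt (10 * \<epsilon>)) \<rho>" if "0 < \<rho>" "\<rho> < 1" for \<rho>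
    unfolding f by (rule localized_of_band_convergence[OF k z[unfolded f] band conv])
      (use params K_pos eps that in auto)
  show "\<exists>\<rho>. 0 < \<rho> \<and> \<rho> < 1 \<and> localized_pseudo_eigenvectors ?A k f z (\<delta> * K * sqrt (10 * \<epsilon>)) \<rho>"
    using loc[of "1 / 2"] by (intro exI[of _ "1 / 2"]) auto
  fix \<rho> r :: real
  assume "(0 < r \<and> r \<le> \<rho> \<and> \<rho> < 1 \<and> z \<notin> f ` sphere 0 r \<and> circle_index f r z > 0) \<or>
    (1 / \<rho> \<ge> 1 / r \<and> 1 / r > 1 \<and> z \<notin> f ` sphere 0 (1 / r) \<and> circle_index f (1 / r) z < 0)"
  \<comment> \<open>In the second alternative \<open>1 / \<rho> > 1\<close>, which also excludes
    \<open>\<rho> \<le> 0\<close>.\<close>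
  hence "0 < \<rho> \<and> \<rho> < 1"
  proof
    assume "1 / \<rho> \<ge> 1 / r \<and> 1 / r > 1 \<and> z \<notin> f ` sphere 0 (1 / r) \<and> circle_index f (1 / r) z < 0"
    hence "1 / \<rho> > 1"
      by linarith
    thus ?thesis
      by (simp add: less_divide_eq_1) linarith
  qed auto
  thus "localized_pseudo_eigenvectors ?A k f z (\<delta> * K * sqrt (10 * \<epsilon>)) \<rho>"
    using loc by blast
qed

end
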